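(* The integrality gap of $[\mathrm{LP}(C)]$ in the case of restricted identical machines is lower bounded by $2$.
   Context: Scheduling malleable jobs on restricted identical machines. An instance consists of a finite set $\mathcal{J}$ of jobs, a finite set $\mathcal{M}$ of machines, for each job $j$ a set $\mathcal{M}_j \subseteq \mathcal{M}$, defining speeds $s_{i,j} = 1$ if $i \in \mathcal{M}_j$ and $s_{i,j} = 0$ otherwise, and for each job $j$ a processing time function $f_j$ defined on $\mathbb{R}_+$ with $f_j(0)=+\infty$, $f_j(s)\in\mathbb{R}_+$ for $s>0$, $f_j(s)$ non-increasing in $s$, and $s\cdot f_j(s)$ non-decreasing in $s>0$. For $S \subseteq \mathcal{M}$ let $\sigma_j(S) = \sum_{i \in S} s_{i,j}$ and $f_j(S) := f_j(\sigma_j(S))$. A feasible schedule chooses for each job $j$ a set $S_j \subseteq \mathcal{M}$ and a start time $\tau_j \ge 0$; job $j$ occupies all machines of $S_j$ (non-preemptively and in unison) during $[\tau_j, \tau_j + f_j(S_j)]$, and each machine processes at most one job at a time. The makespan is $\max_{j} (\tau_j + f_j(S_j))$ and $\mathrm{OPT}$ is the minimum makespan. For a target makespan $C > 0$ let $\gamma_j = \gamma_j(C) := \min\{q \in \mathbb{Z}_+ : f_j(q) \le C\}$ (assumed to exist for every $j$) and $r_{i,j} := \max\{s_{i,j}, \gamma_j(C)\}$. The feasibility program $[\mathrm{LP}(C)]$ in variables $x_{i,j}$ is: $\sum_{i \in \mathcal{M}} x_{i,j} = 1$ for all $j \in \mathcal{J}$; $\sum_{j \in \mathcal{J}} \frac{f_j(r_{i,j})\,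 r_{i,j}}{s_{i,j}} x_{i,j} \le C$ for all $i \in \mathcal{M}$; $x_{i,j} \ge 0$ for all $i,j$. Convention: $x_{i,j} = 0$ is required whenever $s_{i,j} = 0$ (and that term is dropped from the sum). The integrality gap of $[\mathrm{LP}(C)]$ in this case is the supremum over all such instances of the ratio $\mathrm{OPT}/C^*$, where $C^*$ is the infimum of all $C>0$ for which $[\mathrm{LP}(C)]$ is feasible. *)

theory Defs
  imports Complex_Main "HOL-Library.Extended_Nonnegative_Real"
begin

record ('j, 'm) malleable_instance =
  jobs :: "'j set"
  machines :: "'m set"
  eligible :: "'j \<Rightarrow> 'm set"
  proc_time :: "'j \<Rightarrow> real \<Rightarrow> ennreal"

text \<open>The values of \<open>proc_time\<close> at negative reals are irrelevant. Nonnegativity of processing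
  times is built into the type \<^typ>\<open>ennreal\<close>.\<close>

definition valid_instance :: "('j, 'm) malleable_instance \<Rightarrow> bool" where
  "valid_instance I \<longleftrightarrow>
     finite (jobs I) \<and> finite (machines I) \<and>
     (\<forall>j\<in>jobs I.
        eligible I j \<subseteq> machines I \<and>
        proc_time I j 0 = \<infinity> \<and>
        (\<forall>s>0. proc_time I j s < \<infinity>) \<and>
        (\<forall>s t. 0 \<le> s \<and> s \<le> t \<longrightarrow> proc_time I j t \<le> proc_time I j s) \<and>
        (\<forall>s t. 0 < s \<and> s \<le> t \<longrightarrow>
           ennreal s * proc_time I j s \<le> ennreal t * proc_time I j t))"

definition speed :: "('j, 'm) malleable_instance \<Rightarrow> 'm \<Rightarrow> 'j \<Rightarrow> real" where
  "speed I i j = (if i \<in> eligible I j then 1 else 0)"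

definition total_speed :: "('j, 'm) malleable_instance \<Rightarrow> 'j \<Rightarrow> 'm set \<Rightarrow> real" where
  "total_speed I j S = (\<Sum>i\<in>S. speed I i j)"

definition set_time :: "('j, 'm) malleable_instance \<Rightarrow> 'j \<Rightarrow> 'm set \<Rightarrow> ennreal" where
  "set_time I j S = proc_time I j (total_speed I j S)"

text \<open>A schedule is given by the machine sets \<open>S\<close> and the start times \<open>\<tau>\<close>. Two jobs sharing a
  machine may touch at the endpoints of their processing intervals, but not overlap otherwise.
  A job whose machine set has total speed \<open>0\<close> never completes; the makespan is then \<open>\<infinity>\<close>.\<close>

definition feasible_schedule ::
  "('j, 'm) malleable_instance \<Rightarrow> ('j \<Rightarrow> 'm set) \<Rightarrow> ('j \<Rightarrow> real) \<Rightarrow> bool" where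
  "feasible_schedule I S \<tau> \<longleftrightarrow>
     (\<forall>j\<in>jobs I. S j \<subseteq> machines I \<and> 0 \<le> \<tau> j) \<and>
     (\<forall>j\<in>jobs I. \<forall>k\<in>jobs I. j \<noteq> k \<and> S j \<inter> S k \<noteq> {} \<longrightarrow>
        ennreal (\<tau> j) + set_time I j (S j) \<le> ennreal (\<tau> k) \<or>
        ennreal (\<tau> k) + set_time I k (S k) \<le> ennreal (\<tau> j))"

definition makespan ::
  "('j, 'm) malleable_instance \<Rightarrow> ('j \<Rightarrow> 'm set) \<Rightarrow> ('j \<Rightarrow> real) \<Rightarrow> ennreal" where
  "makespan I S \<tau> = (SUP j\<in>jobs I. ennreal (\<tau> j) + set_time I j (S j))"

text \<open>The infimum is a minimum: for finitely many jobs and machines there are finitely many choices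
  of the sets \<open>S\<close> and of the processing orders, each with an earliest schedule.\<close>

definition OPT :: "('j, 'm) malleable_instance \<Rightarrow> ennreal" where
  "OPT I = Inf {makespan I S \<tau> | S \<tau>. feasible_schedule I S \<tau>}"

definition gamma_exists :: "('j, 'm) malleable_instance \<Rightarrow> real \<Rightarrow> 'j \<Rightarrow> bool" where
  "gamma_exists I C j \<longleftrightarrow> (\<exists>q::nat. proc_time I j (real q) \<le> ennreal C)"

definition lp_gamma :: "('j, 'm) malleable_instance \<Rightarrow> real \<Rightarrow> 'j \<Rightarrow> nat" where
  "lp_gamma I C j = (LEAST q::nat. proc_time I j (real q) \<le> ennreal C)"

definition lp_r :: "('j, 'm) malleable_instance \<Rightarrow> real \<Rightarrow> 'm \<Rightarrow> 'j \<Rightarrow> real" where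
  "lp_r I C i j = max (speed I i j) (real (lp_gamma I C j))"

text \<open>\<open>[LP(C)]\<close> only makes sense if all \<open>\<gamma>\<^sub>j(C)\<close> exist, so this is part of its feasibility. In that
  case \<open>\<gamma>\<^sub>j(C) \<ge> 1\<close> because \<open>f\<^sub>j(0) = \<infinity>\<close>; hence \<open>r\<^sub>i\<^sub>j \<ge> 1\<close>, the processing time \<open>f\<^sub>j(r\<^sub>i\<^sub>j)\<close> is finite,
  and \<^const>\<open>enn2real\<close> does not change its value.\<close>

definition lp_solution ::
  "('j, 'm) malleable_instance \<Rightarrow> real \<Rightarrow> ('m \<Rightarrow> 'j \<Rightarrow> real) \<Rightarrow> bool" where
  "lp_solution I C x \<longleftrightarrow>
     (\<forall>j\<in>jobs I. (\<Sum>i\<in>machines I. x i j) = 1) \<and>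
     (\<forall>i\<in>machines I.
        (\<Sum>j\<in>{j \<in> jobs I. speed I i j \<noteq> 0}.
           enn2real (proc_time I j (lp_r I C i j)) * lp_r I C i j / speed I i j * x i j) \<le> C) \<and>
     (\<forall>i\<in>machines I. \<forall>j\<in>jobs I. 0 \<le> x i j) \<and>
     (\<forall>i\<in>machines I. \<forall>j\<in>jobs I. speed I i j = 0 \<longrightarrow> x i j = 0)"

definition lp_feasible :: "('j, 'm) malleable_instance \<Rightarrow> real \<Rightarrow> bool" where
  "lp_feasible I C \<longleftrightarrow> (\<forall>j\<in>jobs I. gamma_exists I C j) \<and> (\<exists>x. lp_solution I C x)"

definition lp_value :: "('j, 'm) malleable_instance \<Rightarrow> ennreal" where
  "lp_value I = Inf {ennreal C | C. 0 < C \<and> lp_feasible I C}"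

text \<open>Jobs and machines are natural numbers here; since both sets are finite, every instance is
  isomorphic to one of this form. The supremum ranges over the instances for which the quotient is
  defined, i.e. \<open>C\<^sup>*\<close> is neither \<open>0\<close> nor \<open>\<infinity>\<close> (the infimum of the empty set).\<close>

definition integrality_gap :: ennreal where
  "integrality_gap =
     Sup {OPT I / lp_value I | I :: (nat, nat) malleable_instance.
            valid_instance I \<and> 0 < lp_value I \<and> lp_value I < \<infinity>}"

end

theory Submission
  imports Defs
begin

text \<open>Take \<open>m\<close> machines and \<open>m + 1\<close> jobs, every job eligible everywhere and needing time \<open>1\<close> at every
  positive speed, so that parallelism does not help. Spreading the jobs evenly solves \<open>[LP(C)]\<close> for
  \<open>C = (m + 1) / m\<close>. A schedule of makespan below \<open>2\<close> starts every job before time \<open>1\<close>, so no two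
  jobs can share a machine, which contradicts the pigeonhole principle. Hence the ratio is at
  least \<open>2 m / (m + 1)\<close>, which tends to \<open>2\<close>.\<close>

definition unit_jobs :: "nat \<Rightarrow> (nat, nat) malleable_instance" where
  "unit_jobs m = \<lparr>jobs = {..m}, machines = {..<m}, eligible = (\<lambda>_. {..<m}),
     proc_time = (\<lambda>_ s. if s \<le> 0 then \<infinity> else 1)\<rparr>"

lemma unit_jobs_simps [simp]:
  "jobs (unit_jobs m) = {..m}"
  "machines (unit_jobs m) = {..<m}"
  "eligible (unit_jobs m) j = {..<m}"
  "proc_time (unit_jobs m) j s = (if s \<le> 0 then \<infinity> else 1)"
  by (simp_all add: unit_jobs_def)

lemma valid_unit_jobs: "valid_instance (unit_jobs m)"
  by (auto simp: valid_instance_def intro: ennreal_leI)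

lemma makespan_unit_jobs_ge:
  assumes "feasible_schedule (unit_jobs m) S \<tau>"
  shows "2 \<le> makespan (unit_jobs m) S \<tau>"
proof (rule ccontr)
  assume "\<not> 2 \<le> makespan (unit_jobs m) S \<tau>"
  then have less: "ennreal (\<tau> j) + set_time (unit_jobs m) j (S j) < 2" if "j \<le> m" for j
    using that unfolding makespan_def not_le by (auto dest: SUP_lessD)
  have set_time_ge: "1 \<le> set_time (unit_jobs m) j (S j)" for j
    by (simp add: set_time_def)
  have start: "ennreal (\<tau> j) < 1" if "j \<le> m" for j
  proof (rule ccontr)
    assume "\<not> ennreal (\<tau> j) < 1"
    then have "1 + 1 \<le> ennreal (\<tau> j) + set_time (unit_jobs m) j (S j)"
      by (intro add_mono set_time_ge) simp
    with less[OF that] show False by simp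
  qed
  \<comment> \<open>The empty set has total speed 0 and so processing time \<infinity>, against
    \<open>less\<close>.\<close>
  have "S j \<noteq> {}" if "j \<le> m" for j
    using less[OF that] by (auto simp: set_time_def total_speed_def)
  then have "\<forall>j\<in>{..m}. \<exists>i. i \<in> S j" by blast
  then obtain g where g: "\<And>j. j \<le> m \<Longrightarrow> g j \<in> S j"
    by (metis atMost_iff)
  have "g ` {..m} \<subseteq> {..<m}"
    using assms g unfolding feasible_schedule_def by fastforce
  then have "\<not> inj_on g {..m}"
    using card_inj_on_le[of g "{..m}" "{..<m}"] by auto
  then obtain j k where jk: "j \<le> m" "k \<le> m" "j \<noteq> k" "g j = g k"
    by (auto simp: inj_on_def)
  then have "S j \<inter> S k \<noteq> {}" using g by (metis disjoint_iff)
  with assms jk have "ennreal (\<tau> j) + set_time (unit_jobs m) j (S j) \<le> ennreal (\<tau> k) \<or>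
      ennreal (\<tau> k) + set_time (unit_jobs m) k (S k) \<le> ennreal (\<tau> j)"
    by (simp add: feasible_schedule_def)
  \<comment> \<open>Whichever of the two jobs comes second on the shared machine waits at least one
    unit of time for the other.\<close>
  then have "1 \<le> ennreal (\<tau> k) \<or> 1 \<le> ennreal (\<tau> j)"
    using set_time_ge by (meson add_increasing order_trans zero_le)
  then show False using start jk by (auto simp: not_le[symmetric])
qed

lemma OPT_unit_jobs_ge: "2 \<le> OPT (unit_jobs m)"
  by (auto simp: OPT_def intro!: Inf_greatest makespan_unit_jobs_ge)

text \<open>Speed 0 takes time \<infinity> and never meets a real target, whereas speed 1 meets
  every target C \<ge> 1. As a result \<open>lp_r\<close> is 1 throughout and all coefficients of
  the program equal 1.\<close>

lemma lp_gamma_unit_jobs: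
  assumes "1 \<le> C"
  shows "lp_gamma (unit_jobs m) C j = 1"
  unfolding lp_gamma_def
  by (rule Least_equality) (use assms in \<open>auto simp: Suc_le_eq top_unique split: if_splits\<close>)

lemma lp_feasible_unit_jobs:
  assumes "0 < m"
  shows "lp_feasible (unit_jobs m) ((1 + real m) / real m)"
proof -
  let ?C = "(1 + real m) / real m"
  have C: "1 \<le> ?C" using assms by (simp add: field_simps)
  have "gamma_exists (unit_jobs m) ?C j" for j
    unfolding gamma_exists_def using C by (intro exI[of _ 1]) simp
  \<comment> \<open>Each machine gets the fraction 1/m of each of the m + 1 jobs, so its load is
    exactly \<open>?C\<close>.\<close>
  moreover have "lp_solution (unit_jobs m) ?C (\<lambda>_ _. 1 / real m)"
    using assms by (simp add: lp_solution_def lp_r_def lp_gamma_unit_jobs[OF C] speed_def)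
  ultimately show ?thesis by (auto simp: lp_feasible_def)
qed

lemma lp_value_unit_jobs_le:
  assumes "0 < m"
  shows "lp_value (unit_jobs m) \<le> ennreal ((1 + real m) / real m)"
proof -
  have "0 < (1 + real m) / real m" using assms by simp
  then show ?thesis
    unfolding lp_value_def using lp_feasible_unit_jobs[OF assms] by (intro Inf_lower) blast
qed

text \<open>No processing time is below 1, so for C < 1 no \<gamma> exists. The bound is needed only
  for positivity, which admits the instance to the supremum.\<close>

lemma lp_value_unit_jobs_ge: "1 \<le> lp_value (unit_jobs m)"
proof -
  have "1 \<le> C" if "lp_feasible (unit_jobs m) C" for C
    using that by (auto simp: lp_feasible_def gamma_exists_def top_unique split: if_splits)
  then show ?thesis by (auto simp: lp_value_def intro!: Inf_greatest)
qed

lemma ennreal_inverse_antimono: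
  fixes a b :: ennreal
  assumes "a \<le> b"
  shows "inverse b \<le> inverse a"
  using assms
  by (simp add: less_eq_ennreal.rep_eq inverse_ennreal.rep_eq ereal_inverse_antimono)

lemma integrality_gap_ge:
  assumes "0 < m"
  shows "ennreal (2 / ((1 + real m) / real m)) \<le> integrality_gap"
proof -
  let ?I = "unit_jobs m"
  have pos: "0 < (1 + real m) / real m" using assms by simp
  have "ennreal (2 / ((1 + real m) / real m)) = 2 / ennreal ((1 + real m) / real m)"
    using pos divide_ennreal[of 2 "(1 + real m) / real m"] by simp
  also have "\<dots> \<le> OPT ?I / lp_value ?I"
    unfolding divide_ennreal_def
    by (intro mult_mono OPT_unit_jobs_ge ennreal_inverse_antimono lp_value_unit_jobs_le[OF assms])
      simp_all
  also have "\<dots> \<le> integrality_gap"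
  proof -
    have "0 < lp_value ?I"
      using lp_value_unit_jobs_ge by (rule less_le_trans[rotated]) simp
    moreover have "lp_value ?I < \<infinity>"
      using lp_value_unit_jobs_le[OF assms] by (rule le_less_trans) simp
    ultimately show ?thesis
      unfolding integrality_gap_def using valid_unit_jobs by (intro Sup_upper) blast
  qed
  finally show ?thesis .
qed

theorem theorem5p3: "integrality_gap \<ge> 2"
proof -
  \<comment> \<open>The shift to \<open>Suc m\<close> keeps the number of machines positive;
    dividing out turns the ratio into a function of an inverse that tends to 0.\<close>
  have "(\<lambda>m. 2 / (1 + inverse (real (Suc m)))) \<longlonglongrightarrow> 2 / (1 + 0)"
    by (intro tendsto_intros LIMSEQ_inverse_real_of_nat) simp
  moreover have "2 / (1 + inverse (real (Suc m))) = 2 / ((1 + real (Suc m)) / real (Suc m))" for m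
    by (simp add: field_simps)
  ultimately have "(\<lambda>m. ennreal (2 / ((1 + real (Suc m)) / real (Suc m)))) \<longlonglongrightarrow> ennreal 2"
    by (intro tendsto_ennrealI) simp
  then have "ennreal 2 \<le> integrality_gap"
    by (rule LIMSEQ_le_const2) (use integrality_gap_ge in blast)
  then show ?thesis by simp
qed

end
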